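(* Suppose that $\{a_n\}_{n\ge 0}$ is a periodic sequence of real numbers with minimal odd period $p\ge 1$, and consider the difference equation $$x_{n+1}=x_{n-1}e^{a_n-x_{n-1}-x_n},\qquad n\ge 0. \tag{E}$$ Let $t_0>0$ be a fixed real number, let $t_{k}=t_0^{(-1)^k}e^{(-1)^k s_k}$ with $s_k=\sum_{j=1}^{k}(-1)^j a_{j-1}$ for $k\ge 1$, let $g_k(x)=t_kxe^{-x}$ for $k\ge 0$ and $x\in(0,\infty)$, and let $\sigma=\sum_{j=1}^{p}(-1)^ja_{j-1}$. Let $f=g_{q-1}\circ g_{q-2}\circ\cdots\circ g_1\circ g_0$, where $q$ is a period of the sequence $\{t_n\}$: $q=2p$ in (a), (c), (d), and $q=p$ in (b). (a) If $s$ is a periodic point of $f$ with period $\omega$, then all solutions of (E) with initial values $x_{-1}=s$ and $x_0=t_0se^{-s}$ (i.e. $(x_{-1},x_0)$ is on the curve $g_0$) have period $2p\omega$. (b) If $t_0=e^{-\sigma/2}$ and $s$ is a periodic point of $f$ with period $\omega$, then all solutions of (E) with initial values $x_{-1}=s$ and $x_0=se^{-\sigma/2-s}$ have period $p\omega$ (in this case the graph of $g_0$ is an invariant set of (E) in the state-plane). (c) If the map $f$ has a non-periodic point, then (E) has a non-periodic solution. (d) If $f$ has a period-three point, then (E) has periodic solutions of period $2pn$ for all positive integers $n$, as well as chaotic solutions in the sense of Li-Yorke.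
   Context: Solutions of (E) have positive initial values $x_{-1},x_0$, and $f$ is a map of the interval $(0,\infty)$; points of $f$ are taken in $(0,\infty)$. The state-plane is the plane of pairs $(x_{n-1},x_n)$. Unless "minimal" is stated, a sequence has period $m$ if $x_{n+m}=x_n$ for all indices $n$, with $m$ not necessarily the minimal period. A point $s$ is periodic for $f$ with period $\omega\ge 1$ if $f^{\omega}(s)=s$; it is non-periodic if $f^n(s)\ne s$ for all $n\ge1$. A period-three point is a point of minimal period three. "Chaotic solutions in the sense of Li-Yorke" means: there is an uncountable set of non-periodic solutions of (E) such that any two distinct members $\{x_n\},\{x_n'\}$ satisfy $\limsup_{n\to\infty}|x_n-x_n'|>0$ and $\liminf_{n\to\infty}|x_n-x_n'|=0$.
   Formalization: In (b), invariance of the graph of g_0 is stated for the map advancing the state by p steps from the initial time; invariance at every step fails for p>1 (e.g. p=3 with a_1≠a_2, where t_1≠t_0) and agrees with this for p=1. *)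

theory Defs
  imports Complex_Main "HOL-Library.Extended_Real" "HOL-Library.Countable_Set"
begin

definition has_period :: "(nat \<Rightarrow> 'a) \<Rightarrow> nat \<Rightarrow> bool" where
  "has_period x m \<longleftrightarrow> m \<ge> 1 \<and> (\<forall>n. x (n + m) = x n)"

definition has_minimal_period :: "(nat \<Rightarrow> 'a) \<Rightarrow> nat \<Rightarrow> bool" where
  "has_minimal_period x m \<longleftrightarrow> has_period x m \<and> (\<forall>k. has_period x k \<longrightarrow> m \<le> k)"

definition nonperiodic :: "(nat \<Rightarrow> 'a) \<Rightarrow> bool" where
  "nonperiodic x \<longleftrightarrow> \<not> (\<exists>m. has_period x m)"

text \<open>The maps below are total functions on the reals, regarded as maps of the interval
  \<open>(0, \<infinity>)\<close>; hence the explicit positivity of the points.\<close>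

definition periodic_point :: "(real \<Rightarrow> real) \<Rightarrow> real \<Rightarrow> nat \<Rightarrow> bool" where
  "periodic_point f s \<omega> \<longleftrightarrow> s > 0 \<and> \<omega> \<ge> 1 \<and> (f ^^ \<omega>) s = s"

definition minimal_periodic_point :: "(real \<Rightarrow> real) \<Rightarrow> real \<Rightarrow> nat \<Rightarrow> bool" where
  "minimal_periodic_point f s \<omega> \<longleftrightarrow>
     periodic_point f s \<omega> \<and> (\<forall>k. periodic_point f s k \<longrightarrow> \<omega> \<le> k)"

definition nonperiodic_point :: "(real \<Rightarrow> real) \<Rightarrow> real \<Rightarrow> bool" where
  "nonperiodic_point f s \<longleftrightarrow> s > 0 \<and> (\<forall>n\<ge>1. (f ^^ n) s \<noteq> s)"

text \<open>A solution \<open>(x\<^sub>-\<^sub>1, x\<^sub>0, x\<^sub>1, \<dots>)\<close> is encoded with its index shifted by one: \<open>x n\<close> stands for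
  the term with index \<open>n - 1\<close>, so the initial values are \<open>x 0\<close> and \<open>x 1\<close>. The coefficient
  sequence \<open>a\<close> is not shifted.\<close>

definition solution :: "(nat \<Rightarrow> real) \<Rightarrow> (nat \<Rightarrow> real) \<Rightarrow> bool" where
  "solution a x \<longleftrightarrow> x 0 > 0 \<and> x 1 > 0 \<and>
     (\<forall>n. x (n + 2) = x n * exp (a n - x n - x (n + 1)))"

definition alt_sum :: "(nat \<Rightarrow> real) \<Rightarrow> nat \<Rightarrow> real" where
  "alt_sum a k = (\<Sum>j=1..k. (-1) ^ j * a (j - 1))"

text \<open>For \<open>k = 0\<close> this returns \<open>t0\<close> if \<open>t0 > 0\<close>, since \<open>alt_sum a 0 = 0\<close>.\<close>

definition tseq :: "(nat \<Rightarrow> real) \<Rightarrow> real \<Rightarrow> nat \<Rightarrow> real" where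
  "tseq a t0 k = t0 powi ((-1) ^ k) * exp ((-1) ^ k * alt_sum a k)"

definition gmap :: "(nat \<Rightarrow> real) \<Rightarrow> real \<Rightarrow> nat \<Rightarrow> real \<Rightarrow> real" where
  "gmap a t0 k x = tseq a t0 k * x * exp (- x)"

text \<open>\<open>fmap a t0 q\<close> is the composition of \<open>gmap a t0 k\<close> for \<open>k < q\<close>, with \<open>k = 0\<close> innermost.\<close>

primrec fmap :: "(nat \<Rightarrow> real) \<Rightarrow> real \<Rightarrow> nat \<Rightarrow> real \<Rightarrow> real" where
  "fmap a t0 0 = id"
| "fmap a t0 (Suc q) = gmap a t0 q \<circ> fmap a t0 q"

definition graph_pos :: "(real \<Rightarrow> real) \<Rightarrow> (real \<times> real) set" where
  "graph_pos g = {(u, g u) | u. u > 0}"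

text \<open>The equation is nonautonomous with coefficients of period \<open>p\<close>, so invariance of a set of the
  state-plane refers to the map advancing the state by \<open>p\<close> steps from index 0: a solution
  starting in \<open>S\<close> lies in \<open>S\<close> at every multiple of \<open>p\<close>. For \<open>p = 1\<close> this is invariance at all
  times; for \<open>p > 1\<close> the curve considered here is in general left in between. In the shifted
  indexing \<open>(x n, x (n + 1))\<close> is the state at time \<open>n\<close>.\<close>

definition invariant_set :: "(nat \<Rightarrow> real) \<Rightarrow> nat \<Rightarrow> (real \<times> real) set \<Rightarrow> bool" where
  "invariant_set a p S \<longleftrightarrow>
     (\<forall>x. solution a x \<longrightarrow> (x 0, x 1) \<in> S \<longrightarrow> (\<forall>k. (x (k * p), x (k * p + 1)) \<in> S))"

definition li_yorke_chaotic :: "(nat \<Rightarrow> real) \<Rightarrow> bool" where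
  "li_yorke_chaotic a \<longleftrightarrow>
     (\<exists>S. uncountable S \<and> (\<forall>x\<in>S. solution a x \<and> nonperiodic x) \<and>
        (\<forall>x\<in>S. \<forall>y\<in>S. x \<noteq> y \<longrightarrow>
           limsup (\<lambda>n. ereal \<bar>x n - y n\<bar>) > 0 \<and> liminf (\<lambda>n. ereal \<bar>x n - y n\<bar>) = 0))"

end

theory Submission
  imports Defs "HOL-Analysis.Line_Segment"
begin

text \<open>
  Along a solution put \<open>r\<^sub>n = x\<^sub>n / (x\<^sub>n\<^sub>-\<^sub>1 exp (- x\<^sub>n\<^sub>-\<^sub>1))\<close>. The equation turns into the linear
  recursion \<open>r\<^sub>n\<^sub>+\<^sub>1 = exp a\<^sub>n / r\<^sub>n\<close> for the logarithm of \<open>r\<close>, which does not involve \<open>x\<close>, and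
  \<open>tseq\<close> solves the same recursion (\<open>tseq_Suc\<close>). Hence a solution that starts on the curve \<open>g\<^sub>0\<close>
  satisfies \<open>x\<^sub>n = g\<^sub>n x\<^sub>n\<^sub>-\<^sub>1\<close> for ever (\<open>solution_on_curve\<close>), so it is the orbit of its first value
  under a periodic sequence of interval maps. Each step of the recursion
  reflects \<open>ln r\<close>, so an odd number of steps does as well, and the first \<open>p\<close> steps reflect it
  at \<open>- \<sigma> / 2\<close>. The next \<open>p\<close> steps repeat this reflection, and it is an involution, so the
  maps repeat with period \<open>2 p\<close>; at the fixed point of the reflection, \<open>t\<^sub>0 = exp (- \<sigma> / 2)\<close>, they
  repeat with period \<open>p\<close>. Sampling the solution once per period gives the orbit of \<open>s\<close> under \<open>f\<close>
  (\<open>fmap_add_multiple\<close>), which settles the statements on periodic and non-periodic points.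

  The rest is the Li--Yorke theorem for a continuous self-map \<open>f\<close> of \<open>(0, \<infinity>)\<close>.
  Let \<open>a \<rightarrow> b \<rightarrow> c \<rightarrow> a\<close> be a three-cycle with \<open>b\<close> between the other two points.
  Since \<open>f\<close> maps the segment \<open>[b, c]\<close> over \<open>[a, c]\<close>, it has a fixed point there, whose solution
  has period \<open>2 p\<close> and thus every multiple of it. Moreover some \<open>e\<close> in \<open>[b, c]\<close>
  different from \<open>b\<close> is mapped to \<open>b\<close>, and then \<open>f\<^sup>3\<close> maps each of the disjoint segments
  \<open>[a, b]\<close> and \<open>[e, c]\<close> over \<open>[a, c]\<close>: this is a horseshoe for \<open>g = f\<^sup>3\<close>
  (\<open>period_three_horseshoe\<close>).

  A horseshoe yields a scrambled set (\<open>horseshoe_scrambled_set\<close>). Any sequence of compact sets in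
  which each covers the next under an iterate of \<open>g\<close> is followed by some orbit
  (\<open>covering_itinerary\<close>). Bisection provides arbitrarily short intervals \<open>C\<^sub>k\<close> that \<open>g\<^sup>k\<close> maps over
  the whole horseshoe (\<open>horseshoe_small_cover\<close>). So orbits exist that pass through all the \<open>C\<^sub>k\<close> at
  common times, and just before each passage visit the left or the right interval as
  prescribed by a binary sequence. Any two of them come arbitrarily close in the \<open>C\<^sub>k\<close>, and they
  are separated infinitely often if their binary sequences differ infinitely often. Finally a
  Li--Yorke pair cannot consist of two periodic orbits, so discarding at most one point leaves
  an uncountable scrambled set of non-periodic points.
\<close>

section \<open>Li--Yorke pairs of sequences\<close>

text \<open>The two conditions bound \<open>limsup \<bar>u - v\<bar>\<close> from below and \<open>liminf \<bar>u - v\<bar>\<close> from above. Stated with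
  \<open>frequently\<close>, they pass from a subsequence to the whole sequence without any limit calculus.\<close>

definition li_yorke_pair :: "(nat \<Rightarrow> real) \<Rightarrow> (nat \<Rightarrow> real) \<Rightarrow> bool" where
  "li_yorke_pair u v \<longleftrightarrow>
     (\<exists>\<delta>>0. \<exists>\<^sub>F n in sequentially. \<delta> \<le> \<bar>u n - v n\<bar>) \<and>
     (\<forall>\<epsilon>>0. \<exists>\<^sub>F n in sequentially. \<bar>u n - v n\<bar> < \<epsilon>)"

lemma li_yorke_pair_limsup_liminf:
  assumes "li_yorke_pair u v"
  shows "limsup (\<lambda>n. ereal \<bar>u n - v n\<bar>) > 0" and "liminf (\<lambda>n. ereal \<bar>u n - v n\<bar>) = 0"
proof -
  obtain \<delta> where \<delta>: "\<delta> > 0" "\<exists>\<^sub>F n in sequentially. \<delta> \<le> \<bar>u n - v n\<bar>"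
    and small: "\<And>\<epsilon>. \<epsilon> > 0 \<Longrightarrow> \<exists>\<^sub>F n in sequentially. \<bar>u n - v n\<bar> < \<epsilon>"
    using assms unfolding li_yorke_pair_def by blast
  show "limsup (\<lambda>n. ereal \<bar>u n - v n\<bar>) > 0"
  proof (rule ccontr)
    assume "\<not> ?thesis"
    then have "limsup (\<lambda>n. ereal \<bar>u n - v n\<bar>) < ereal \<delta>"
      using \<delta>(1) by (meson ereal_less(2) le_less_trans not_le)
    then have "\<forall>\<^sub>F n in sequentially. ereal \<bar>u n - v n\<bar> < ereal \<delta>"
      by (rule Limsup_lessD)
    then show False
      using \<delta>(2) by (simp add: frequently_def not_le)
  qed
  show "liminf (\<lambda>n. ereal \<bar>u n - v n\<bar>) = 0"
  proof (rule antisym)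
    show "liminf (\<lambda>n. ereal \<bar>u n - v n\<bar>) \<le> 0"
    proof (rule ccontr)
      assume "\<not> ?thesis"
      then obtain \<epsilon> where \<epsilon>: "0 < ereal \<epsilon>" "ereal \<epsilon> < liminf (\<lambda>n. ereal \<bar>u n - v n\<bar>)"
        using ereal_dense2[of 0] by (auto simp: not_le)
      have "\<forall>\<^sub>F n in sequentially. ereal \<epsilon> < ereal \<bar>u n - v n\<bar>"
        by (rule less_LiminfD[OF \<epsilon>(2)])
      then have "\<forall>\<^sub>F n in sequentially. \<not> \<bar>u n - v n\<bar> < \<epsilon>"
        by (rule eventually_mono) simp
      then show False
        using small[of \<epsilon>] \<epsilon>(1) by (simp add: frequently_def)
    qed
  qed (simp add: Liminf_bounded)
qed

text \<open>This transfers the property from \<open>f\<^sup>3\<close> to \<open>f\<close> and from \<open>f\<close>, the map over one period, to the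
  solutions.\<close>

lemma li_yorke_pair_subsequence:
  assumes "k > 0" and pair: "li_yorke_pair (\<lambda>n. u (n * k)) (\<lambda>n. v (n * k))"
  shows "li_yorke_pair u v"
proof -
  have sub: "\<exists>\<^sub>F n in sequentially. P n" if freq: "\<exists>\<^sub>F n in sequentially. P (n * k)" for P
    unfolding frequently_sequentially
  proof
    fix N
    obtain n where "n \<ge> N" "P (n * k)"
      using freq unfolding frequently_sequentially by blast
    moreover have "n \<le> n * k"
      using \<open>k > 0\<close> by simp
    ultimately show "\<exists>n\<ge>N. P n"
      by (meson order_trans)
  qed
  show ?thesis
    using pair sub[of "\<lambda>n. \<delta> \<le> \<bar>u n - v n\<bar>" for \<delta>] sub[of "\<lambda>n. \<bar>u n - v n\<bar> < \<epsilon>" for \<epsilon>]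
    unfolding li_yorke_pair_def by meson
qed

lemma not_li_yorke_pair_refl: "\<not> li_yorke_pair u u"
  by (auto simp: li_yorke_pair_def)

lemma funpow_fixed_mult:
  assumes "(F ^^ m) x = x"
  shows "(F ^^ (k * m)) x = x"
  by (induction k) (simp_all add: funpow_add assms)

text \<open>For two periodic orbits the distance takes only finitely many values, the terms of one common
  period. If it is frequently small it must vanish once, and then the orbits coincide, because
  a periodic point can be recovered from any point of its orbit.\<close>

lemma li_yorke_pair_not_both_periodic:
  assumes pair: "li_yorke_pair (\<lambda>n. (F ^^ n) x) (\<lambda>n. (F ^^ n) y)"
    and x: "(F ^^ m) x = x" "m \<ge> 1" and y: "(F ^^ m') y = y" "m' \<ge> 1"
  shows False
proof -
  define M where "M = m * m'"
  have M: "M > 0" "(F ^^ M) x = x" "(F ^^ M) y = y"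
    using x y funpow_fixed_mult[of m F x m'] funpow_fixed_mult[of m' F y m]
    by (auto simp: M_def mult.commute)
  define dist where "dist i = \<bar>(F ^^ i) x - (F ^^ i) y\<bar>" for i
  have pos: "dist i > 0" if "i < M" for i
  proof (rule ccontr)
    assume "\<not> dist i > 0"
    then have "(F ^^ i) x = (F ^^ i) y"
      by (simp add: dist_def)
    then have "(F ^^ (M - i)) ((F ^^ i) x) = (F ^^ (M - i)) ((F ^^ i) y)"
      by simp
    then have "x = y"
      using that M by (simp flip: funpow_add[THEN fun_cong, unfolded comp_def])
    then show False
      using pair not_li_yorke_pair_refl by blast
  qed
  define \<epsilon> where "\<epsilon> = Min (dist ` {..<M})"
  have "\<epsilon> > 0"
    unfolding \<epsilon>_def using M(1) pos by (subst Min_gr_iff) auto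
  then have "\<exists>\<^sub>F n in sequentially. dist n < \<epsilon>"
    using pair by (simp add: li_yorke_pair_def dist_def)
  then obtain n where n: "dist n < \<epsilon>"
    by (rule frequentlyE)
  have "dist n = dist (n mod M)"
    unfolding dist_def using M by (simp add: funpow_mod_eq)
  moreover have "\<epsilon> \<le> dist (n mod M)"
    unfolding \<epsilon>_def using M(1) by (intro Min_le) auto
  ultimately show False
    using n by simp
qed

section \<open>Scrambled sets from horseshoes\<close>

lemma continuous_on_funpow:
  assumes "continuous_on D g" "g ` D \<subseteq> D"
  shows "continuous_on D (g ^^ n)"
proof (induction n)
  case (Suc n)
  have "(g ^^ n) ` D \<subseteq> D"
    using assms(2) by (induction n) auto
  then have "continuous_on D (g \<circ> (g ^^ n))"
    using Suc continuous_on_subset[OF assms(1)] by (intro continuous_on_compose) auto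
  then show ?case
    by simp
qed (simp add: id_def)

text \<open>Pulling back from the end, the covering relations show that every finite part of the itinerary is
  realised; the sets of points that realise the first \<open>n\<close> stages are compact and decreasing, so a
  single point realises all of them.\<close>

lemma covering_itinerary:
  fixes g :: "real \<Rightarrow> real"
  assumes cont: "continuous_on D g" and inv: "g ` D \<subseteq> D"
    and A: "\<And>n. compact (A n)" "\<And>n. A n \<subseteq> D" "\<And>n. A n \<noteq> {}"
    and cover: "\<And>n. A (Suc n) \<subseteq> (g ^^ m n) ` A n"
  obtains x where "\<And>n. (g ^^ (\<Sum>i<n. m i)) x \<in> A n"
proof -
  define T where "T n = (\<Sum>i<n. m i)" for n
  define B where "B n = {x \<in> A 0. \<forall>i\<le>n. (g ^^ T i) x \<in> A i}" for n
  have onto: "\<exists>x\<in>B n. (g ^^ T n) x = y" if "y \<in> A n" for n y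
    using that
  proof (induction n arbitrary: y)
    case 0
    then show ?case
      by (auto simp: B_def T_def)
  next
    case (Suc n)
    then obtain z where z: "z \<in> A n" "y = (g ^^ m n) z"
      using cover by blast
    obtain x where x: "x \<in> B n" "(g ^^ T n) x = z"
      using Suc.IH[OF z(1)] by blast
    have step: "(g ^^ T (Suc n)) x = y"
      using x(2) z(2) by (simp add: T_def funpow_add add.commute)
    have "x \<in> B (Suc n)"
      using x(1) step Suc.prems by (auto simp: B_def le_Suc_eq)
    then show ?case
      using step by blast
  qed
  have cont_n: "continuous_on (A 0) (g ^^ k)" for k
    using continuous_on_subset[OF continuous_on_funpow[OF cont inv] A(2)] .
  have closed: "closed (B n)" for n
  proof -
    have "closed (A 0 \<inter> (g ^^ T i) -` A i)" for i
      using cont_n A(1) by (intro continuous_closed_preimage compact_imp_closed)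
    moreover have "B n = (\<Inter>i\<in>{..n}. A 0 \<inter> (g ^^ T i) -` A i)"
      by (auto simp: B_def)
    ultimately show ?thesis
      by (metis (no_types, lifting) closed_INT)
  qed
  have "compact (B n)" for n
  proof -
    have "B n = A 0 \<inter> B n"
      by (auto simp: B_def)
    then show ?thesis
      using compact_Int_closed[OF A(1) closed] by metis
  qed
  moreover have "B n \<noteq> {}" for n
    using onto A(3) by blast
  moreover have "B k \<subseteq> B n" if "n \<le> k" for n k
    using that by (auto simp: B_def)
  ultimately obtain x where "x \<in> \<Inter>(range B)"
    using compact_nest[of B] by blast
  then have "(g ^^ T n) x \<in> A n" for n
    by (auto simp: B_def)
  then show ?thesis
    using that by (auto simp: T_def)
qed

lemma halving_interval:
  fixes u v y :: real
  assumes "y \<in> {u..v}"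
  obtains u' v' where "u' \<le> v'" "{u'..v'} \<subseteq> {u..v}" "v' - u' = (v - u) / 2"
    "closed_segment ((u + v) / 2) y \<subseteq> {u'..v'}"
proof (cases "y \<le> (u + v) / 2")
  case True
  then show ?thesis
    using assms by (intro that[of u "(u + v) / 2"]) (auto simp: closed_segment_eq_real_ivl field_simps)
next
  case False
  then show ?thesis
    using assms by (intro that[of "(u + v) / 2" v]) (auto simp: closed_segment_eq_real_ivl field_simps)
qed

lemma closed_segment_image_cover:
  fixes h :: "real \<Rightarrow> real"
  assumes "continuous_on (closed_segment u v) h"
  shows "closed_segment (h u) (h v) \<subseteq> h ` closed_segment u v"
  using IVT'_closed_segment_real[OF _ assms] by (metis image_iff subsetI)

text \<open>Bisection: \<open>h = g\<^sup>k\<close> maps the current interval over \<open>[a, d]\<close>. If \<open>h\<close> sends the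
  midpoint to the left of \<open>c\<close>, then the half that contains a preimage of \<open>d\<close> is mapped over
  \<open>[c, d]\<close>; otherwise the half that contains a preimage of \<open>a\<close> is mapped over \<open>[a, b]\<close>. In both
  cases one more application of \<open>g\<close> covers \<open>[a, d]\<close> again.\<close>

lemma horseshoe_small_cover:
  fixes g :: "real \<Rightarrow> real"
  assumes cont: "continuous_on D g" and inv: "g ` D \<subseteq> D" and D: "{a..d} \<subseteq> D"
    and ord: "a \<le> b" "b < c" "c \<le> d"
    and left: "{a..d} \<subseteq> g ` {a..b}" and right: "{a..d} \<subseteq> g ` {c..d}"
  shows "\<exists>u v. u \<le> v \<and> {u..v} \<subseteq> {a..d} \<and> v - u = (d - a) / 2 ^ k \<and> {a..d} \<subseteq> (g ^^ k) ` {u..v}"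
proof (induction k)
  case 0
  show ?case
    using ord by (intro exI[of _ a] exI[of _ d]) auto
next
  case (Suc k)
  then obtain u v where uv: "u \<le> v" "{u..v} \<subseteq> {a..d}" "v - u = (d - a) / 2 ^ k"
    and onto: "{a..d} \<subseteq> (g ^^ k) ` {u..v}"
    by blast
  define h where "h = g ^^ k"
  define w where "w = (u + v) / 2"
  have w: "w \<in> {u..v}"
    using uv(1) by (auto simp: w_def field_simps)
  have "\<exists>y\<in>{u..v}. \<exists>I\<in>{{a..b}, {c..d}}. I \<subseteq> closed_segment (h w) (h y)"
  proof (cases "h w < c")
    case True
    obtain y where "y \<in> {u..v}" "h y = d"
      using onto ord unfolding h_def by (metis atLeastAtMost_iff imageE order.trans less_imp_le order_refl subsetD)
    then show ?thesis
      using True by (intro bexI[of _ y] bexI[of _ "{c..d}"]) (auto simp: closed_segment_eq_real_ivl)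
  next
    case False
    obtain y where "y \<in> {u..v}" "h y = a"
      using onto ord unfolding h_def by (metis atLeastAtMost_iff imageE order.trans less_imp_le order_refl subsetD)
    then show ?thesis
      using False ord by (intro bexI[of _ y] bexI[of _ "{a..b}"]) (auto simp: closed_segment_eq_real_ivl)
  qed
  then obtain y I where y: "y \<in> {u..v}" and I: "I \<in> {{a..b}, {c..d}}" "I \<subseteq> closed_segment (h w) (h y)"
    by blast
  obtain u' v' where half: "u' \<le> v'" "{u'..v'} \<subseteq> {u..v}" "v' - u' = (v - u) / 2"
    "closed_segment w y \<subseteq> {u'..v'}"
    using halving_interval[OF y] unfolding w_def by blast
  have "continuous_on (closed_segment w y) h"
    using continuous_on_funpow[OF cont inv, of k] half(2,4) uv(2) D
    unfolding h_def by (meson continuous_on_subset order_trans)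
  then have "I \<subseteq> h ` {u'..v'}"
    using closed_segment_image_cover[of w y h] I(2) half(4) by blast
  then have "g ` I \<subseteq> (g ^^ Suc k) ` {u'..v'}"
    by (auto simp: h_def)
  moreover have "{a..d} \<subseteq> g ` I"
    using I(1) left right by blast
  ultimately have "{a..d} \<subseteq> (g ^^ Suc k) ` {u'..v'}"
    by blast
  then show ?case
    using half uv by (intro exI[of _ u'] exI[of _ v']) auto
qed

lemma uncountable_nat_sets: "uncountable (UNIV :: nat set set)"
proof
  assume "countable (UNIV :: nat set set)"
  then have "range (from_nat_into (UNIV :: nat set set)) = Pow UNIV"
    by (simp add: range_from_nat_into)
  then show False
    using Cantors_theorem by blast
qed

text \<open>The scrambled points are indexed by sets of natural numbers. Stage \<open>k\<close> of the itinerary of \<open>X W\<close>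
  starts in the interval selected by \<open>sym W k\<close>, enters \<open>C k\<close> one step later, and after another \<open>k\<close> steps
  can be anywhere in the horseshoe; so all points reach \<open>C k\<close> at the same time. This
  coincidence of times makes the orbits close, and the choice of the interval separates them.\<close>

lemma horseshoe_scrambled_set:
  fixes g :: "real \<Rightarrow> real"
  assumes cont: "continuous_on D g" and inv: "g ` D \<subseteq> D" and D: "{a..d} \<subseteq> D"
    and ord: "a \<le> b" "b < c" "c \<le> d"
    and left: "{a..d} \<subseteq> g ` {a..b}" and right: "{a..d} \<subseteq> g ` {c..d}"
  obtains S where "uncountable S" "S \<subseteq> {a..d}"
    "\<And>x y. x \<in> S \<Longrightarrow> y \<in> S \<Longrightarrow> x \<noteq> y \<Longrightarrow> li_yorke_pair (\<lambda>n. (g ^^ n) x) (\<lambda>n. (g ^^ n) y)"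
proof -
  have "\<forall>k. \<exists>C. compact C \<and> C \<noteq> {} \<and> C \<subseteq> {a..d} \<and> (\<forall>x\<in>C. \<forall>y\<in>C. \<bar>x - y\<bar> \<le> (d - a) / 2 ^ k) \<and>
    {a..d} \<subseteq> (g ^^ k) ` C"
  proof
    fix k
    obtain u v where uv: "u \<le> v" "{u..v} \<subseteq> {a..d}" "v - u = (d - a) / 2 ^ k"
      "{a..d} \<subseteq> (g ^^ k) ` {u..v}"
      using horseshoe_small_cover[OF assms] by blast
    then show "\<exists>C. compact C \<and> C \<noteq> {} \<and> C \<subseteq> {a..d} \<and>
      (\<forall>x\<in>C. \<forall>y\<in>C. \<bar>x - y\<bar> \<le> (d - a) / 2 ^ k) \<and> {a..d} \<subseteq> (g ^^ k) ` C"
      by (intro exI[of _ "{u..v}"]) auto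
  qed
  then obtain C where C: "\<And>k. compact (C k)" "\<And>k. C k \<noteq> {}" "\<And>k. C k \<subseteq> {a..d}"
    "\<And>k x y. x \<in> C k \<Longrightarrow> y \<in> C k \<Longrightarrow> \<bar>x - y\<bar> \<le> (d - a) / 2 ^ k"
    "\<And>k. {a..d} \<subseteq> (g ^^ k) ` C k"
    by metis
  define I where "I s = (if s then {a..b} else {c..d})" for s
  have I: "I s \<subseteq> {a..d}" "{a..d} \<subseteq> g ` I s" "compact (I s)" for s
    using left right ord by (auto simp: I_def)
  define E where "E k s = I s \<inter> g -` C k" for k s
  have gE: "C k \<subseteq> g ` E k s" for k s
    using C(3)[of k] I(2)[of s] by (fastforce simp: E_def)
  have E: "compact (E k s)" "E k s \<noteq> {}" "E k s \<subseteq> {a..d}" for k s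
  proof -
    have "continuous_on (I s) g"
      using continuous_on_subset[OF cont] I(1) D by (meson order_trans)
    then have "closed (E k s)"
      unfolding E_def using I(3) C(1)
      by (intro continuous_closed_preimage compact_imp_closed)
    then have "compact (I s \<inter> E k s)"
      using I(3) by (rule compact_Int_closed[rotated])
    then show "compact (E k s)"
      by (simp add: E_def)
    show "E k s \<noteq> {}"
      using gE[of k s] C(2)[of k] by blast
    show "E k s \<subseteq> {a..d}"
      using I(1) by (auto simp: E_def)
  qed
  have cover: "E (Suc k) s' \<subseteq> (g ^^ Suc k) ` E k s" for k s s'
  proof -
    have "E (Suc k) s' \<subseteq> (g ^^ k) ` C k"
      using E(3) C(5) by blast
    also have "\<dots> \<subseteq> (g ^^ k) ` (g ` E k s)"
      using gE by (rule image_mono)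
    also have "\<dots> = (g ^^ Suc k) ` E k s"
      by (simp only: image_comp funpow_Suc_right)
    finally show ?thesis .
  qed
  define T where "T k = (\<Sum>i<k. Suc i)" for k
  have T: "k \<le> T k" for k
    by (induction k) (auto simp: T_def)
  \<comment> \<open>Every membership question \<open>j \<in> W\<close> is asked infinitely often, so that distinct sets have
    symbol sequences that differ infinitely often.\<close>
  define sym where "sym W k \<longleftrightarrow> fst (prod_decode k) \<in> W" for W :: "nat set" and k
  have "\<exists>x. \<forall>k. (g ^^ T k) x \<in> E k (sym W k)" for W
  proof -
    have "E k (sym W k) \<subseteq> D" for k
      using E(3) D by (rule order_trans)
    then obtain x where "\<And>k. (g ^^ (\<Sum>i<k. Suc i)) x \<in> E k (sym W k)"
      using covering_itinerary[OF cont inv, of "\<lambda>k. E k (sym W k)" Suc] E(1,2) cover by metis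
    then show ?thesis
      by (auto simp: T_def)
  qed
  then obtain X where X: "\<And>W k. (g ^^ T k) (X W) \<in> E k (sym W k)"
    by metis
  have pair: "li_yorke_pair (\<lambda>n. (g ^^ n) (X V)) (\<lambda>n. (g ^^ n) (X W))" if "V \<noteq> W" for V W
    unfolding li_yorke_pair_def
  proof (intro conjI allI impI)
    obtain j where j: "(j \<in> V) \<noteq> (j \<in> W)"
      using \<open>V \<noteq> W\<close> by blast
    have "\<exists>\<^sub>F n in sequentially. c - b \<le> \<bar>(g ^^ n) (X V) - (g ^^ n) (X W)\<bar>"
      unfolding frequently_sequentially
    proof
      fix N
      define k where "k = prod_encode (j, N)"
      have "N \<le> T k"
        using T[of k] le_prod_encode_2[of N j] by (simp add: k_def)
      moreover have "sym V k \<noteq> sym W k"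
        using j by (simp add: sym_def k_def)
      then have "c - b \<le> \<bar>(g ^^ T k) (X V) - (g ^^ T k) (X W)\<bar>"
        using X[of k V] X[of k W] by (auto simp: E_def I_def split: if_splits)
      ultimately show "\<exists>n\<ge>N. c - b \<le> \<bar>(g ^^ n) (X V) - (g ^^ n) (X W)\<bar>"
        by blast
    qed
    then show "\<exists>\<delta>>0. \<exists>\<^sub>F n in sequentially. \<delta> \<le> \<bar>(g ^^ n) (X V) - (g ^^ n) (X W)\<bar>"
      using ord by (intro exI[of _ "c - b"]) auto
  next
    fix \<epsilon> :: real
    assume "\<epsilon> > 0"
    have "(\<lambda>k. (d - a) * (1 / 2) ^ k) \<longlonglongrightarrow> (d - a) * 0"
      by (intro tendsto_intros) auto
    then have "\<forall>\<^sub>F k in sequentially. (d - a) * (1 / 2) ^ k < \<epsilon>"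
      using \<open>\<epsilon> > 0\<close> by (intro order_tendstoD) auto
    then obtain K where K: "\<And>k. k \<ge> K \<Longrightarrow> (d - a) / 2 ^ k < \<epsilon>"
      by (auto simp: eventually_sequentially power_one_over)
    show "\<exists>\<^sub>F n in sequentially. \<bar>(g ^^ n) (X V) - (g ^^ n) (X W)\<bar> < \<epsilon>"
      unfolding frequently_sequentially
    proof
      fix N
      define k where "k = max K N"
      have "(g ^^ Suc (T k)) (X U) \<in> C k" for U
        using X[of k U] by (simp add: E_def)
      then have "\<bar>(g ^^ Suc (T k)) (X V) - (g ^^ Suc (T k)) (X W)\<bar> \<le> (d - a) / 2 ^ k"
        by (intro C(4))
      also have "\<dots> < \<epsilon>"
        by (rule K) (simp add: k_def)
      finally have "\<bar>(g ^^ Suc (T k)) (X V) - (g ^^ Suc (T k)) (X W)\<bar> < \<epsilon>" .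
      moreover have "N \<le> Suc (T k)"
        using T[of k] by (simp add: k_def)
      ultimately show "\<exists>n\<ge>N. \<bar>(g ^^ n) (X V) - (g ^^ n) (X W)\<bar> < \<epsilon>"
        by blast
    qed
  qed
  have "inj X"
  proof (rule injI)
    fix V W
    assume "X V = X W"
    then show "V = W"
      using pair[of V W] not_li_yorke_pair_refl by metis
  qed
  then have "uncountable (range X)"
    using uncountable_nat_sets countable_image_inj_on by blast
  moreover have "range X \<subseteq> {a..d}"
    using X[of 0] E(3) by (auto simp: T_def)
  moreover have "li_yorke_pair (\<lambda>n. (g ^^ n) x) (\<lambda>n. (g ^^ n) y)"
    if "x \<in> range X" "y \<in> range X" "x \<noteq> y" for x y
    using that pair by (metis imageE)
  ultimately show ?thesis
    using that by blast
qed

section \<open>Period three\<close>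

text \<open>Naming the cycle from its middle point leaves two mirror-image orders. Unordered
  segments treat both at once in the lemmas that follow.\<close>

lemma three_cycle_middle:
  fixes f :: "real \<Rightarrow> real"
  assumes "minimal_periodic_point f s 3" and pos: "\<And>x. x > 0 \<Longrightarrow> f x > 0"
  obtains a b c where "a > 0" "b > 0" "c > 0" "f a = b" "f b = c" "f c = a"
    "a < b \<and> b < c \<or> c < b \<and> b < a"
proof -
  have s: "s > 0" "f (f (f s)) = s"
    using assms(1) by (auto simp: minimal_periodic_point_def periodic_point_def numeral_3_eq_3)
  have low: "\<not> periodic_point f s 1" "\<not> periodic_point f s 2"
    using assms(1) by (auto simp: minimal_periodic_point_def)
  have ne: "f s \<noteq> s" "f (f s) \<noteq> s"
    using low s(1) by (auto simp: periodic_point_def numeral_2_eq_2)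
  then have ne': "f (f s) \<noteq> f s"
    using s(2) by metis
  have p: "f s > 0" "f (f s) > 0"
    using s(1) pos by auto
  consider "f (f s) < s \<and> s < f s \<or> f s < s \<and> s < f (f s)"
    | "s < f s \<and> f s < f (f s) \<or> f (f s) < f s \<and> f s < s"
    | "f s < f (f s) \<and> f (f s) < s \<or> s < f (f s) \<and> f (f s) < f s"
    using ne ne' by linarith
  then show ?thesis
    using that[of "f (f s)" s "f s"] that[of s "f s" "f (f s)"] that[of "f s" "f (f s)" s] s p
    by metis
qed

lemma period_three_fixed_point:
  fixes f :: "real \<Rightarrow> real"
  assumes cont: "continuous_on {0<..} f" and pos: "b > 0" "c > 0"
    and cyc: "f b = c" "f c = a"  and mid: "a < b \<and> b < c \<or> c < b \<and> b < a"
  obtains z where "z > 0" "f z = z"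
proof -
  have seg: "closed_segment b c \<subseteq> {0<..}"
    using pos by (auto simp: closed_segment_eq_real_ivl)
  define h where "h x = f x - x" for x
  have "continuous_on (closed_segment b c) h"
    unfolding h_def by (intro continuous_intros continuous_on_subset[OF cont seg])
  moreover have "0 \<in> closed_segment (h b) (h c)"
    using mid cyc by (auto simp: h_def closed_segment_eq_real_ivl)
  ultimately obtain z where "z \<in> closed_segment b c" "h z = 0"
    using IVT'_closed_segment_real[of 0 h b c] by blast
  then show ?thesis
    using seg that[of z] by (auto simp: h_def)
qed

text \<open>Under \<open>f\<close>, \<open>[a, b]\<close> covers \<open>[b, c]\<close>, and \<open>[b, c]\<close> covers \<open>[a, c]\<close>. These two segments meet in
  \<open>b\<close>. Replacing \<open>[b, c]\<close> by \<open>[e, c]\<close> with \<open>f e = b\<close> separates them, at the cost of one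
  more step: \<open>[e, c]\<close> covers \<open>[a, b]\<close>, hence \<open>[b, c]\<close>, hence \<open>[a, c]\<close>.\<close>

lemma period_three_horseshoe:
  fixes f :: "real \<Rightarrow> real"
  assumes cont: "continuous_on {0<..} f" and pos: "a > 0" "b > 0" "c > 0"
    and cyc: "f a = b" "f b = c" "f c = a" and mid: "a < b \<and> b < c \<or> c < b \<and> b < a"
  obtains l r l' r' where "0 < l" "l \<le> r" "r < l'" "l' \<le> r'"
    "{l..r'} \<subseteq> (f ^^ 3) ` {l..r}" "{l..r'} \<subseteq> (f ^^ 3) ` {l'..r'}"
proof -
  have cover: "closed_segment (f u) (f v) \<subseteq> f ` closed_segment u v" if "u > 0" "v > 0" for u v
    using that by (intro closed_segment_image_cover continuous_on_subset[OF cont])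
      (auto simp: closed_segment_eq_real_ivl)
  have "b \<in> closed_segment (f b) (f c)"
    using cyc mid by (auto simp: closed_segment_eq_real_ivl)
  then obtain e where e: "e \<in> closed_segment b c" "f e = b"
    using cover[OF pos(2,3)] by (metis image_iff subsetD)
  have "e \<noteq> b"
    using e(2) cyc mid by auto
  then have e_pos: "e > 0" and e_mid: "b < e \<and> e \<le> c \<or> c \<le> e \<and> e < b"
    using e(1) pos mid by (auto simp: closed_segment_eq_real_ivl split: if_splits)
  let ?H = "closed_segment a c"
  have ab: "closed_segment b c \<subseteq> f ` closed_segment a b"
    using cover[OF pos(1,2)] cyc by simp
  have bc: "?H \<subseteq> f ` closed_segment b c"
    using cover[OF pos(2,3)] cyc by (simp add: closed_segment_commute)
  have ec: "closed_segment a b \<subseteq> f ` closed_segment e c"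
    using cover[OF e_pos pos(3)] cyc e(2) by (simp add: closed_segment_commute)
  have sub: "closed_segment b c \<subseteq> ?H"
    using mid by (auto simp: closed_segment_eq_real_ivl)
  have f3: "(f ^^ 3) ` U = f ` f ` f ` U" for U
    by (simp add: numeral_3_eq_3 image_comp comp_assoc)
  have trans: "U \<subseteq> f ` f ` W" if "U \<subseteq> f ` V" "V \<subseteq> f ` W" for U V W
    using that by blast
  have "closed_segment b c \<subseteq> f ` f ` closed_segment a b"
    using trans[OF order_trans[OF sub bc] ab] .
  then have K: "?H \<subseteq> (f ^^ 3) ` closed_segment a b"
    unfolding f3 by (rule trans[OF bc])
  have "closed_segment b c \<subseteq> f ` f ` closed_segment e c"
    using trans[OF ab ec] .
  then have M: "?H \<subseteq> (f ^^ 3) ` closed_segment e c"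
    unfolding f3 by (rule trans[OF bc])
  show ?thesis
  proof (cases "a < b")
    case True
    then have "closed_segment a b = {a..b}" "closed_segment e c = {e..c}" "?H = {a..c}"
      using mid e_mid by (auto simp: closed_segment_eq_real_ivl)
    then show ?thesis
      using K M True mid e_mid pos by (intro that[of a b e c]) auto
  next
    case False
    then have "closed_segment a b = {b..a}" "closed_segment e c = {c..e}" "?H = {c..a}"
      using mid e_mid by (auto simp: closed_segment_eq_real_ivl)
    then show ?thesis
      using K M False mid e_mid pos by (intro that[of c e b a]) auto
  qed
qed

lemma period_three_scrambled_set:
  fixes f :: "real \<Rightarrow> real"
  assumes cont: "continuous_on {0<..} f" and pos: "\<And>x. x > 0 \<Longrightarrow> f x > 0"
    and three: "minimal_periodic_point f s 3"
  obtains S where "uncountable S" "\<And>x. x \<in> S \<Longrightarrow> nonperiodic_point f x"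
    "\<And>x y. x \<in> S \<Longrightarrow> y \<in> S \<Longrightarrow> x \<noteq> y \<Longrightarrow> li_yorke_pair (\<lambda>n. (f ^^ n) x) (\<lambda>n. (f ^^ n) y)"
proof -
  obtain a b c where "a > 0" "b > 0" "c > 0" "f a = b" "f b = c" "f c = a"
    "a < b \<and> b < c \<or> c < b \<and> b < a"
    using three_cycle_middle[OF three pos] by blast
  then obtain l r l' r' where H: "0 < l" "l \<le> r" "r < l'" "l' \<le> r'"
    "{l..r'} \<subseteq> (f ^^ 3) ` {l..r}" "{l..r'} \<subseteq> (f ^^ 3) ` {l'..r'}"
    using period_three_horseshoe[OF cont] by metis
  have inv: "f ` {0<..} \<subseteq> {0<..}"
    using pos by auto
  have "(f ^^ 3) ` {0<..} \<subseteq> {0<..}"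
    using pos by (auto simp: numeral_3_eq_3)
  moreover have "{l..r'} \<subseteq> {0<..}"
    using H(1) by auto
  ultimately obtain S where S: "uncountable S" "S \<subseteq> {l..r'}"
    and pair3: "\<And>x y. x \<in> S \<Longrightarrow> y \<in> S \<Longrightarrow> x \<noteq> y \<Longrightarrow>
      li_yorke_pair (\<lambda>n. ((f ^^ 3) ^^ n) x) (\<lambda>n. ((f ^^ 3) ^^ n) y)"
    using horseshoe_scrambled_set[OF continuous_on_funpow[OF cont inv, of 3] _ _ H(2-6)] by metis
  have pair: "li_yorke_pair (\<lambda>n. (f ^^ n) x) (\<lambda>n. (f ^^ n) y)"
    if "x \<in> S" "y \<in> S" "x \<noteq> y" for x y
  proof (rule li_yorke_pair_subsequence)
    show "li_yorke_pair (\<lambda>n. (f ^^ (n * 3)) x) (\<lambda>n. (f ^^ (n * 3)) y)"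
      using pair3[OF that] by (simp add: funpow_mult mult.commute)
  qed simp
  define P where "P = {x \<in> S. \<not> nonperiodic_point f x}"
  have eq: "x = y" if "x \<in> P" "y \<in> P" for x y
  proof (rule ccontr)
    assume "x \<noteq> y"
    have xy: "x \<in> S" "y \<in> S"
      using that by (auto simp: P_def)
    then have "x > 0" "y > 0"
      using S(2) H(1) by auto
    then obtain m m' where "(f ^^ m) x = x" "m \<ge> 1" "(f ^^ m') y = y" "m' \<ge> 1"
      using \<open>x \<in> P\<close> \<open>y \<in> P\<close> by (auto simp: P_def nonperiodic_point_def)
    then show False
      using li_yorke_pair_not_both_periodic pair[OF xy \<open>x \<noteq> y\<close>] by blast
  qed
  have "countable P"
  proof (cases "P = {}")
    case False
    then obtain x where "x \<in> P"
      by blast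
    then have "P \<subseteq> {x}"
      using eq by blast
    then show ?thesis
      by (rule countable_subset) simp
  qed simp
  then have "uncountable (S - P)"
    using S(1) uncountable_minus_countable by blast
  then show ?thesis
  proof (rule that)
    show "nonperiodic_point f x" if "x \<in> S - P" for x
      using that by (simp add: P_def)
    show "li_yorke_pair (\<lambda>n. (f ^^ n) x) (\<lambda>n. (f ^^ n) y)"
      if "x \<in> S - P" "y \<in> S - P" "x \<noteq> y" for x y
      using that by (intro pair) simp_all
  qed
qed

section \<open>Reduction to the interval maps\<close>

lemma alt_sum_Suc: "alt_sum a (Suc k) = alt_sum a k + (-1) ^ Suc k * a k"
  by (simp add: alt_sum_def)

lemma tseq_0: "tseq a t0 0 = t0"
  by (simp add: tseq_def alt_sum_def)

lemma tseq_Suc: "tseq a t0 (Suc k) = exp (a k) / tseq a t0 k"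
proof (cases "even k")
  case True
  then show ?thesis
    by (simp add: tseq_def alt_sum_Suc exp_diff exp_minus field_simps)
next
  case False
  then show ?thesis
    by (simp add: tseq_def alt_sum_Suc exp_add exp_diff exp_minus field_simps)
qed

lemma tseq_pos: "t0 > 0 \<Longrightarrow> tseq a t0 k > 0"
  by (induction k) (simp_all add: tseq_0 tseq_Suc)

lemma tseq_periodic:
  assumes "m \<ge> 1" "\<And>n. a (n + m) = a n" "tseq a t0 m = t0"
  shows "has_period (tseq a t0) m"
proof -
  have "tseq a t0 (n + m) = tseq a t0 n" for n
    by (induction n) (simp_all add: assms tseq_0 tseq_Suc)
  then show ?thesis
    using assms(1) by (simp add: has_period_def)
qed

text \<open>Shifting by an odd number of places flips the sign of every term; this is the reflection of the
  logarithm of \<open>tseq\<close>, and the reason why \<open>p\<close> has to be odd.\<close>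

lemma alt_sum_odd_shift:
  assumes "\<And>n. a (n + p) = a n" "odd p"
  shows "alt_sum a (k + p) = alt_sum a p - alt_sum a k"
proof (induction k)
  case (Suc k)
  then show ?case
    using assms by (simp add: alt_sum_Suc power_add)
qed (simp add: alt_sum_def)

lemma tseq_two_odd_period:
  assumes "\<And>n. a (n + p) = a n" "odd p"
  shows "has_period (tseq a t0) (2 * p)"
proof (rule tseq_periodic)
  have "alt_sum a (2 * p) = 0"
    using alt_sum_odd_shift[of a p p, OF assms] by (simp add: mult_2)
  then show "tseq a t0 (2 * p) = t0"
    by (simp add: tseq_def)
  show "2 * p \<ge> 1"
    using \<open>odd p\<close> by (cases p) auto
  show "a (n + 2 * p) = a n" for n
    using assms(1)[of n] assms(1)[of "n + p"] by (simp add: mult_2 add.assoc)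
qed

lemma tseq_odd_period:
  assumes "\<And>n. a (n + p) = a n" "odd p" "t0 = exp (- alt_sum a p / 2)"
  shows "has_period (tseq a t0) p"
proof (rule tseq_periodic)
  show "tseq a t0 p = t0"
    using assms(2,3) by (simp add: tseq_def flip: exp_minus exp_add)
  show "p \<ge> 1"
    using \<open>odd p\<close> by (cases p) auto
qed (rule assms)

text \<open>Two consecutive maps compose to one step of the difference equation: the factor \<open>tseq a t0 n\<close> in
  the inner map cancels against its inverse in \<open>tseq a t0 (Suc n)\<close>.\<close>

lemma gmap_step:
  assumes "t0 > 0"
  shows "gmap a t0 (Suc n) (gmap a t0 n u) = u * exp (a n - u - gmap a t0 n u)"
proof -
  define w where "w = gmap a t0 n u"
  have "tseq a t0 (Suc n) * w = u * exp (a n - u)"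
    using tseq_pos[OF assms, of a n] by (simp add: w_def gmap_def tseq_Suc exp_diff exp_minus field_simps)
  then have "gmap a t0 (Suc n) w = u * exp (a n - u) * exp (- w)"
    by (simp add: gmap_def)
  then show ?thesis
    by (simp add: w_def mult.assoc flip: exp_add)
qed

lemma solution_on_curve:
  assumes "t0 > 0" and x: "solution a x" "x 1 = gmap a t0 0 (x 0)"
  shows "x (Suc n) = gmap a t0 n (x n)"
proof (induction n)
  case (Suc n)
  have "x (Suc (Suc n)) = x n * exp (a n - x n - x (Suc n))"
    using x(1) by (simp add: solution_def)
  then show ?case
    using Suc gmap_step[OF \<open>t0 > 0\<close>, of a n "x n"] by simp
qed (use x in simp)

lemma solution_eq_fmap:
  assumes "t0 > 0" and x: "solution a x" "x 1 = gmap a t0 0 (x 0)"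
  shows "x n = fmap a t0 n (x 0)"
  by (induction n) (simp_all add: solution_on_curve[OF assms])

lemma fmap_pos: "t0 > 0 \<Longrightarrow> s > 0 \<Longrightarrow> fmap a t0 n s > 0"
  by (induction n) (simp_all add: gmap_def tseq_pos)

lemma fmap_solution:
  assumes "t0 > 0" "s > 0"
  shows "solution a (\<lambda>n. fmap a t0 n s)"
  unfolding solution_def
  using fmap_pos[OF assms, of a 0] fmap_pos[OF assms, of a 1] gmap_step[OF assms(1)] by simp

lemma continuous_on_fmap: "continuous_on A (fmap a t0 n)"
proof (induction n)
  case (Suc n)
  have "continuous_on B (gmap a t0 n)" for B
    unfolding gmap_def by (intro continuous_intros)
  then have "continuous_on A (gmap a t0 n \<circ> fmap a t0 n)"
    using Suc by (intro continuous_on_compose)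
  then show ?case
    by simp
qed (simp add: id_def)

lemma fmap_add_period:
  assumes "has_period (tseq a t0) q"
  shows "fmap a t0 (n + q) s = fmap a t0 n (fmap a t0 q s)"
  using assms by (induction n) (simp_all add: gmap_def has_period_def)

lemma fmap_add_multiple:
  assumes "has_period (tseq a t0) q"
  shows "fmap a t0 (n + k * q) s = fmap a t0 n ((fmap a t0 q ^^ k) s)"
proof (induction k arbitrary: s)
  case (Suc k)
  have "fmap a t0 (n + Suc k * q) s = fmap a t0 (n + k * q) (fmap a t0 q s)"
    using fmap_add_period[OF assms, of "n + k * q" s] by (simp add: algebra_simps)
  also have "\<dots> = fmap a t0 n ((fmap a t0 q ^^ Suc k) s)"
    by (simp only: Suc.IH funpow_Suc_right comp_apply)
  finally show ?case .
qed simp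

lemma fmap_multiple:
  assumes "has_period (tseq a t0) q"
  shows "fmap a t0 (k * q) s = (fmap a t0 q ^^ k) s"
  using fmap_add_multiple[OF assms, of 0 k s] by simp

lemma periodic_point_solution_periodic:
  assumes t: "t0 > 0" "has_period (tseq a t0) q"
    and s: "periodic_point (fmap a t0 q) s \<omega>"
    and x: "solution a x" "x 0 = s" "x 1 = gmap a t0 0 s"
  shows "has_period x (q * \<omega>)"
  unfolding has_period_def
proof (intro conjI allI)
  show "1 \<le> q * \<omega>"
    using t(2) s by (simp add: has_period_def periodic_point_def)
  fix n
  have x_eq: "x n = fmap a t0 n s" for n
    using solution_eq_fmap[OF t(1) x(1)] x(2,3) by simp
  show "x (n + q * \<omega>) = x n"
    using fmap_add_multiple[OF t(2), of n \<omega> s] s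
    by (simp add: x_eq mult.commute periodic_point_def)
qed

text \<open>A period \<open>m\<close> of the solution need not be a multiple of the period \<open>q\<close> of the maps, but \<open>q m\<close> is a
  period as well, and it would give \<open>f\<^sup>m s = s\<close>.\<close>

lemma nonperiodic_point_solution_nonperiodic:
  assumes "has_period (tseq a t0) q" "nonperiodic_point (fmap a t0 q) s"
  shows "nonperiodic (\<lambda>n. fmap a t0 n s)"
  unfolding nonperiodic_def
proof
  assume "\<exists>m. has_period (\<lambda>n. fmap a t0 n s) m"
  then obtain m where m: "m \<ge> 1" "\<And>n. fmap a t0 (n + m) s = fmap a t0 n s"
    by (auto simp: has_period_def)
  have "fmap a t0 (k * m) s = s" for k
  proof (induction k)
    case (Suc k)
    then show ?case
      using m(2)[of "k * m"] by (simp add: add.commute)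
  qed simp
  from this[of q] have "(fmap a t0 q ^^ m) s = s"
    using fmap_multiple[OF assms(1), of m s] by (simp add: mult.commute)
  then show False
    using assms(2) m(1) by (simp add: nonperiodic_point_def)
qed

lemma graph_invariant:
  assumes t: "t0 > 0" "has_period (tseq a t0) p"
  shows "invariant_set a p (graph_pos (gmap a t0 0))"
  unfolding invariant_set_def
proof (intro allI impI)
  fix x k
  assume x: "solution a x" "(x 0, x 1) \<in> graph_pos (gmap a t0 0)"
  then have x1: "x 1 = gmap a t0 0 (x 0)" "x 0 > 0"
    by (auto simp: graph_pos_def)
  have "tseq a t0 (k * p) = tseq a t0 0"
  proof (induction k)
    case (Suc k)
    have "tseq a t0 (k * p + p) = tseq a t0 (k * p)"
      using t(2) unfolding has_period_def by blast
    then show ?case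
      using Suc by (simp add: add.commute)
  qed simp
  then have "x (k * p + 1) = gmap a t0 0 (x (k * p))"
    using solution_on_curve[OF t(1) x(1) x1(1), of "k * p"] by (simp add: gmap_def)
  moreover have "x (k * p) > 0"
    using solution_eq_fmap[OF t(1) x(1) x1(1)] fmap_pos[OF t(1) x1(2)] by metis
  ultimately show "(x (k * p), x (k * p + 1)) \<in> graph_pos (gmap a t0 0)"
    by (auto simp: graph_pos_def)
qed

lemma period_three_li_yorke_chaotic:
  assumes t: "t0 > 0" "has_period (tseq a t0) q"
    and three: "minimal_periodic_point (fmap a t0 q) s 3"
  shows "li_yorke_chaotic a"
proof -
  obtain S where S: "uncountable S" "\<And>s. s \<in> S \<Longrightarrow> nonperiodic_point (fmap a t0 q) s"
    and pair: "\<And>s s'. s \<in> S \<Longrightarrow> s' \<in> S \<Longrightarrow> s \<noteq> s' \<Longrightarrow>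
      li_yorke_pair (\<lambda>n. (fmap a t0 q ^^ n) s) (\<lambda>n. (fmap a t0 q ^^ n) s')"
    using period_three_scrambled_set[OF continuous_on_fmap fmap_pos[OF t(1)] three] by metis
  define X where "X s n = fmap a t0 n s" for s n
  have "inj X"
    by (rule injI) (metis X_def fmap.simps(1) id_apply)
  then have "uncountable (X ` S)"
    using S(1) countable_image_inj_on by (metis inj_on_subset subset_UNIV)
  moreover have "solution a x \<and> nonperiodic x" if "x \<in> X ` S" for x
    using that S(2) fmap_solution[OF t(1)] nonperiodic_point_solution_nonperiodic[OF t(2)]
    unfolding X_def by (auto simp: nonperiodic_point_def)
  moreover have "limsup (\<lambda>n. ereal \<bar>x n - y n\<bar>) > 0 \<and> liminf (\<lambda>n. ereal \<bar>x n - y n\<bar>) = 0"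
    if xy: "x \<in> X ` S" "y \<in> X ` S" "x \<noteq> y" for x y
  proof -
    obtain s s' where s: "s \<in> S" "s' \<in> S" "s \<noteq> s'" "x = X s" "y = X s'"
      using xy by auto
    have "q > 0"
      using t(2) by (simp add: has_period_def)
    moreover have "li_yorke_pair (\<lambda>n. x (n * q)) (\<lambda>n. y (n * q))"
      using pair[OF s(1-3)] by (simp add: s(4,5) X_def fmap_multiple[OF t(2)])
    ultimately have "li_yorke_pair x y"
      by (rule li_yorke_pair_subsequence)
    then show ?thesis
      using li_yorke_pair_limsup_liminf by blast
  qed
  ultimately show ?thesis
    unfolding li_yorke_chaotic_def by (intro exI[of _ "X ` S"] conjI ballI impI) simp_all
qed

lemma period_three_periodic_solutions:
  assumes t: "t0 > 0" "has_period (tseq a t0) q"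
    and three: "minimal_periodic_point (fmap a t0 q) s 3" and "n \<ge> 1"
  shows "\<exists>x. solution a x \<and> has_period x (q * n)"
proof -
  let ?f = "fmap a t0 q"
  obtain u v w where "v > 0" "w > 0" "?f v = w" "?f w = u" "u < v \<and> v < w \<or> w < v \<and> v < u"
    using three_cycle_middle[OF three fmap_pos[OF t(1)]] by blast
  then obtain z where z: "z > 0" "?f z = z"
    by (rule period_three_fixed_point[OF continuous_on_fmap])
  have "(?f ^^ n) z = z"
    using z(2) by (induction n) simp_all
  then have "periodic_point ?f z n"
    using z(1) \<open>n \<ge> 1\<close> by (simp add: periodic_point_def)
  then have "has_period (\<lambda>k. fmap a t0 k z) (q * n)"
    using fmap_solution[OF t(1) z(1)] by (intro periodic_point_solution_periodic[OF t]) simp_all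
  then show ?thesis
    using fmap_solution[OF t(1) z(1)] by blast
qed

theorem theorem13:
  fixes a :: "nat \<Rightarrow> real" and p :: nat and t0 :: real
  assumes "has_minimal_period a p" and "odd p" and "t0 > 0"
  defines "\<sigma> \<equiv> alt_sum a p"
  shows
    "has_period (tseq a t0) (2 * p) \<and>
     (\<forall>s \<omega>. periodic_point (fmap a t0 (2 * p)) s \<omega> \<longrightarrow>
        (\<forall>x. solution a x \<and> x 0 = s \<and> x 1 = t0 * s * exp (- s) \<longrightarrow>
           has_period x (2 * p * \<omega>))) \<and>
     (t0 = exp (- \<sigma> / 2) \<longrightarrow>
        has_period (tseq a t0) p \<and>
        (\<forall>s \<omega>. periodic_point (fmap a t0 p) s \<omega> \<longrightarrow>
           (\<forall>x. solution a x \<and> x 0 = s \<and> x 1 = s * exp (- \<sigma> / 2 - s) \<longrightarrow>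
              has_period x (p * \<omega>))) \<and>
        invariant_set a p (graph_pos (gmap a t0 0))) \<and>
     ((\<exists>s. nonperiodic_point (fmap a t0 (2 * p)) s) \<longrightarrow>
        (\<exists>x. solution a x \<and> nonperiodic x)) \<and>
     ((\<exists>s. minimal_periodic_point (fmap a t0 (2 * p)) s 3) \<longrightarrow>
        (\<forall>n\<ge>1. \<exists>x. solution a x \<and> has_period x (2 * p * n)) \<and>
        li_yorke_chaotic a)"
proof -
  have a: "\<And>n. a (n + p) = a n"
    using assms(1) by (simp add: has_minimal_period_def has_period_def)
  note t2 = tseq_two_odd_period[of a p, OF a \<open>odd p\<close>, of t0]
  have g0: "gmap a t0 0 s = t0 * s * exp (- s)" for s
    by (simp add: gmap_def tseq_0)
  have half: "has_period (tseq a t0) p \<and>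
    (\<forall>s \<omega>. periodic_point (fmap a t0 p) s \<omega> \<longrightarrow>
       (\<forall>x. solution a x \<and> x 0 = s \<and> x 1 = s * exp (- \<sigma> / 2 - s) \<longrightarrow>
          has_period x (p * \<omega>))) \<and>
    invariant_set a p (graph_pos (gmap a t0 0))" if t0: "t0 = exp (- \<sigma> / 2)"
  proof -
    have t1: "has_period (tseq a t0) p"
      using tseq_odd_period[of a p, OF a \<open>odd p\<close>] t0 by (simp add: \<sigma>_def)
    have "exp (- \<sigma> / 2 - s) = t0 * exp (- s)" for s
      unfolding t0 by (simp flip: exp_add)
    then have "gmap a t0 0 s = s * exp (- \<sigma> / 2 - s)" for s
      by (simp add: g0)
    then show ?thesis
      using t1 periodic_point_solution_periodic[OF \<open>t0 > 0\<close> t1] graph_invariant[OF \<open>t0 > 0\<close> t1]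
      by metis
  qed
  have nonper: "\<exists>x. solution a x \<and> nonperiodic x" if "nonperiodic_point (fmap a t0 (2 * p)) s" for s
    using that fmap_solution[OF \<open>t0 > 0\<close>] nonperiodic_point_solution_nonperiodic[OF t2]
    by (auto simp: nonperiodic_point_def)
  show ?thesis
    using t2 half nonper periodic_point_solution_periodic[OF \<open>t0 > 0\<close> t2, unfolded g0]
      period_three_periodic_solutions[OF \<open>t0 > 0\<close> t2] period_three_li_yorke_chaotic[OF \<open>t0 > 0\<close> t2]
    by blast
qed

end
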